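(* Consider a Higgs lagrangian of the two-Higgs-doublet model with orbit-space parameters $\Lambda_{\mu\nu}$ (real symmetric, $\Lambda_{\mu\nu} r^\mu r^\nu>0$ for all $r\in LC^+\setminus\{0\}$), $M_\mu$ (an arbitrary real four-vector) and $K_\mu$ (a real four-vector inside the future lightcone with $K_\mu K^\mu=1$). Let $G$ be the maximal group of explicit symmetries of the Higgs lagrangian. Then: (a) $G$ is non-trivial if and only if there exists an eigenvector $e^\mu$ of $\Lambda_{\mu\nu}$ orthogonal both to $M_\mu$ and to $K_\mu$, i.e. $M_\mu e^\mu = K_\mu e^\mu = 0$; (b) if $G$ is non-trivial, then $G$ is isomorphic to one of the following groups: $\mathbb{Z}_2$, $(\mathbb{Z}_2)^2$, $(\mathbb{Z}_2)^3$, $O(2)$, $O(2)\times \mathbb{Z}_2$, or $O(3)$.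
   Context: Work in $\mathbb{R}^4$ with coordinates $r^\mu = (r_0, r_1, r_2, r_3)$ and Minkowski metric $g = \mathrm{diag}(1,-1,-1,-1)$, used to raise and lower indices. The orbit space is the closed forward lightcone (surface and interior) $LC^+ = \{ r \in \mathbb{R}^4 : r_0 \ge 0,\ r_0^2 - r_1^2 - r_2^2 - r_3^2 \ge 0\}$. The Higgs lagrangian is $L = K_\mu \rho^\mu - V$ with $V = -M_\mu r^\mu + \frac12\Lambda_{\mu\nu} r^\mu r^\nu$, where $\rho^\mu$ is a four-vector built from derivatives of the Higgs fields that transforms in the same way as $r^\mu$ under linear transformations. An explicit (reparametrization) symmetry of the Higgs lagrangian is an invertible linear map $T$ of $\mathbb{R}^4$ with $T(LC^+)=LC^+$ that leaves invariant, separately, the quadratic form $\Lambda_{\mu\nu} r^\mu r^\nu$, the linear form $M_\mu r^\mu$, and the linear form $K_\mu\rho^\mu$ (with $T$ acting on $\rho^\mu$ as on $r^\mu$). $G$ is the group of all such maps. Eigenvectors and eigenvalues of $\Lambda_{\mu\nu}$ are taken with respect to the Minkowski metric: $e\neq 0$ is an eigenvector with eigenvalue $\lambda$ if $\Lambda_{\mu\nu} e^\nu = \lambda\, g_{\mu\nu} e^\nu$. The positivity assumption on $\Lambda_{\mu\nu}$ is equivalent to the existence of a proper Lorentz frame in which $\Lambda_{\mu\nu} = \mathrm{diag}(\Lambda_0,-\Lambda_1,-\Lambda_2,-\Lambda_3)$ with $\Lambda_0>0$ and $\Lambda_0>\Lambda_1,\Lambda_2,\Lambda_3$. *)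

theory Defs
  imports "HOL-Analysis.Analysis" "HOL-Algebra.Elementary_Groups"
begin

text \<open>
  The four coordinates are indexed by \<open>0, 1, 2, 3 :: 4\<close>; in this type \<open>4 = 0\<close>, so the time
  component \<open>r $ 0\<close> is also \<open>r $ 4\<close>.  A lower-index vector is stored by its lower components, so
  that the Euclidean inner product \<open>c \<bullet> r\<close> of a lower-index vector \<open>c\<close> and an upper-index
  vector \<open>r\<close> is the contraction \<open>c\<^sub>\<mu> r\<^sup>\<mu>\<close>, without any metric sign.
\<close>

definition minkowski :: "real^4^4" where
  "minkowski = (\<chi> i j. if i = j then (if i = 0 then 1 else - 1) else 0)"

lemma minkowski_self_inverse: "minkowski ** minkowski = mat 1"
proof -
  have "(\<Sum>k\<in>UNIV. minkowski $ i $ k * minkowski $ k $ j) = (if i = j then 1 else 0)" for i j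
  proof -
    have "(\<Sum>k\<in>UNIV. minkowski $ i $ k * minkowski $ k $ j)
        = (\<Sum>k\<in>UNIV. if k = i then (if i = j then 1 else 0) else 0)"
      by (rule sum.cong) (auto simp: minkowski_def)
    then show ?thesis
      by simp
  qed
  then show ?thesis
    by (simp add: matrix_matrix_mult_def mat_def vec_eq_iff)
qed

lemma matrix_inv_minkowski: "matrix_inv minkowski = minkowski"
proof -
  have "matrix_inv minkowski ** minkowski = mat 1"
    unfolding matrix_inv_def using minkowski_self_inverse
    by (rule someI2[of _ minkowski, OF conjI]) (auto simp: minkowski_self_inverse)
  then have "matrix_inv minkowski ** (minkowski ** minkowski) = minkowski"
    by (simp add: matrix_mul_assoc)
  then show ?thesis
    by (simp add: minkowski_self_inverse)
qed

definition raise_index :: "real^4 \<Rightarrow> real^4" where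
  "raise_index c = matrix_inv minkowski *v c"

definition forward_lightcone :: "(real^4) set" where
  "forward_lightcone =
     {r. r $ 0 \<ge> 0 \<and> (r $ 0)\<^sup>2 - (r $ 1)\<^sup>2 - (r $ 2)\<^sup>2 - (r $ 3)\<^sup>2 \<ge> 0}"

definition linear_form :: "real^4 \<Rightarrow> real^4 \<Rightarrow> real" where
  "linear_form c r = c \<bullet> r"

definition quadratic_form :: "real^4^4 \<Rightarrow> real^4 \<Rightarrow> real" where
  "quadratic_form \<Lambda> r = r \<bullet> (\<Lambda> *v r)"

definition higgs_potential :: "real^4^4 \<Rightarrow> real^4 \<Rightarrow> real^4 \<Rightarrow> real" where
  "higgs_potential \<Lambda> M r = - linear_form M r + 1 / 2 * quadratic_form \<Lambda> r"

definition higgs_lagrangian ::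
  "real^4^4 \<Rightarrow> real^4 \<Rightarrow> real^4 \<Rightarrow> real^4 \<Rightarrow> real^4 \<Rightarrow> real" where
  "higgs_lagrangian \<Lambda> M K r \<rho> = linear_form K \<rho> - higgs_potential \<Lambda> M r"

definition explicit_symmetry ::
  "real^4^4 \<Rightarrow> real^4 \<Rightarrow> real^4 \<Rightarrow> (real^4 \<Rightarrow> real^4) \<Rightarrow> bool" where
  "explicit_symmetry \<Lambda> M K T \<longleftrightarrow>
     linear T \<and> bij T \<and> T ` forward_lightcone = forward_lightcone \<and>
     (\<forall>r. quadratic_form \<Lambda> (T r) = quadratic_form \<Lambda> r) \<and>
     (\<forall>r. linear_form M (T r) = linear_form M r) \<and>
     (\<forall>\<rho>. linear_form K (T \<rho>) = linear_form K \<rho>)"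

lemma explicit_symmetry_lagrangian:
  "explicit_symmetry \<Lambda> M K T \<Longrightarrow>
     higgs_lagrangian \<Lambda> M K (T r) (T \<rho>) = higgs_lagrangian \<Lambda> M K r \<rho>"
  by (simp add: explicit_symmetry_def higgs_lagrangian_def higgs_potential_def)

definition symmetry_group ::
  "real^4^4 \<Rightarrow> real^4 \<Rightarrow> real^4 \<Rightarrow> (real^4 \<Rightarrow> real^4) monoid" where
  "symmetry_group \<Lambda> M K = \<lparr>carrier = {T. explicit_symmetry \<Lambda> M K T}, mult = (\<circ>), one = id\<rparr>"

lemma group_symmetry_group: "group (symmetry_group \<Lambda> M K)"
proof (rule groupI)
  fix S T assume "S \<in> carrier (symmetry_group \<Lambda> M K)" "T \<in> carrier (symmetry_group \<Lambda> M K)"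
  then show "S \<otimes>\<^bsub>symmetry_group \<Lambda> M K\<^esub> T \<in> carrier (symmetry_group \<Lambda> M K)"
    by (auto simp: symmetry_group_def explicit_symmetry_def linear_compose bij_comp
        simp flip: image_image)
next
  fix T assume "T \<in> carrier (symmetry_group \<Lambda> M K)"
  then have T: "linear T" "bij T" "T ` forward_lightcone = forward_lightcone"
    "\<And>r. quadratic_form \<Lambda> (T r) = quadratic_form \<Lambda> r"
    "\<And>r. linear_form M (T r) = linear_form M r"
    "\<And>r. linear_form K (T r) = linear_form K r"
    by (auto simp: symmetry_group_def explicit_symmetry_def)
  have T_inv: "T (inv_into UNIV T r) = r" for r
    using \<open>bij T\<close> by (simp add: bij_is_surj surj_f_inv_f)
  have "explicit_symmetry \<Lambda> M K (inv_into UNIV T)"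
    unfolding explicit_symmetry_def
  proof (intro conjI allI)
    show "linear (inv_into UNIV T)"
      using T(1,2) by (metis bij_is_inj bij_is_surj inj_linear_imp_inv_linear)
    show "bij (inv_into UNIV T)"
      using T(2) by (rule bij_imp_bij_inv)
    show "inv_into UNIV T ` forward_lightcone = forward_lightcone"
      using T(2,3) by (metis bij_is_inj image_inv_f_f)
    show "quadratic_form \<Lambda> (inv_into UNIV T r) = quadratic_form \<Lambda> r" for r
      using T(4)[of "inv_into UNIV T r"] by (simp add: T_inv)
    show "linear_form M (inv_into UNIV T r) = linear_form M r" for r
      using T(5)[of "inv_into UNIV T r"] by (simp add: T_inv)
    show "linear_form K (inv_into UNIV T r) = linear_form K r" for r
      using T(6)[of "inv_into UNIV T r"] by (simp add: T_inv)
  qed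
  moreover have "inv_into UNIV T \<circ> T = id"
    using T(2) by (simp add: bij_is_inj)
  ultimately show "\<exists>S\<in>carrier (symmetry_group \<Lambda> M K).
      S \<otimes>\<^bsub>symmetry_group \<Lambda> M K\<^esub> T = \<one>\<^bsub>symmetry_group \<Lambda> M K\<^esub>"
    by (auto simp: symmetry_group_def)
qed (auto simp: symmetry_group_def explicit_symmetry_def linear_id o_assoc)

text \<open>
  Eigenvectors with respect to the Minkowski metric:
  \<open>\<Lambda>\<^sub>\<mu>\<^sub>\<nu> e\<^sup>\<nu> = \<lambda> g\<^sub>\<mu>\<^sub>\<nu> e\<^sup>\<nu>\<close>, not \<open>\<Lambda> *v e = \<lambda> *\<^sub>R e\<close>.
\<close>

definition minkowski_eigenvector :: "real^4^4 \<Rightarrow> real^4 \<Rightarrow> bool" where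
  "minkowski_eigenvector \<Lambda> e \<longleftrightarrow> e \<noteq> 0 \<and> (\<exists>l. \<Lambda> *v e = l *\<^sub>R (minkowski *v e))"

definition orthogonal_group :: "(real^'n^'n) monoid" where
  "orthogonal_group = \<lparr>carrier = {Q. orthogonal_matrix Q}, mult = (**), one = mat 1\<rparr>"

lemma group_orthogonal_group: "group (orthogonal_group :: (real^'n^'n) monoid)"
proof (rule groupI)
  fix Q :: "real^'n^'n" assume "Q \<in> carrier orthogonal_group"
  then have "transpose Q \<in> carrier orthogonal_group" "transpose Q ** Q = mat 1"
    by (auto simp: orthogonal_group_def orthogonal_matrix_def)
  then show "\<exists>P\<in>carrier orthogonal_group. P \<otimes>\<^bsub>orthogonal_group\<^esub> Q = \<one>\<^bsub>orthogonal_group\<^esub>"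
    by (intro bexI[of _ "Finite_Cartesian_Product.transpose Q"]) (auto simp: orthogonal_group_def)
qed (auto simp: orthogonal_group_def orthogonal_matrix_mul orthogonal_matrix_id matrix_mul_assoc)

abbreviation Z2 :: "int monoid" where "Z2 \<equiv> integer_mod_group 2"
abbreviation O2 :: "(real^2^2) monoid" where "O2 \<equiv> orthogonal_group"
abbreviation O3 :: "(real^3^3) monoid" where "O3 \<equiv> orthogonal_group"

end

theory Submission
  imports Defs
begin

text \<open>
  A symmetry \<open>T\<close> maps the interior of the lightcone onto itself, hence preserves the null cone, so it
  is conformal for the Minkowski product; fixing the unit timelike covector \<open>K\<close> forces the factor to
  be \<open>1\<close>. Thus \<open>T\<close> fixes the vector \<open>k\<close> dual to \<open>K\<close> and is an orthogonal map on the
  three-dimensional spacelike complement of \<open>k\<close>, commuting with \<open>A = g\<^sup>-\<^sup>1 \<Lambda>\<close> and preserving the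
  linear form \<open>M\<close>. Take a maximal orthonormal system of eigenvectors of \<open>A\<close> annihilated by \<open>K\<close> and
  \<open>M\<close>: the range of \<open>T - 1\<close> lies in its span, so \<open>G\<close> is the group of orthogonal matrices of size at
  most \<open>3\<close> that commute with the diagonal matrix of the eigenvalues. The pattern of coincidences
  among the eigenvalues gives the list of groups.
\<close>

section \<open>The Minkowski product\<close>

definition mprod :: "real^4 \<Rightarrow> real^4 \<Rightarrow> real" where
  "mprod x y = x \<bullet> (minkowski *v y)"

lemma minkowski_vector: "minkowski *v y = (\<chi> i. if i = 0 then y $ i else - y $ i)"
proof -
  have "(\<Sum>j\<in>UNIV. minkowski $ i $ j * y $ j) = (\<Sum>j\<in>UNIV. if j = i then (if i = 0 then y $ i else - y $ i) else 0)" for i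
    by (rule sum.cong) (auto simp: minkowski_def)
  then show ?thesis
    by (simp add: vec_eq_iff matrix_vector_mult_def)
qed

lemma sum_4_zero: "(\<Sum>i\<in>(UNIV :: 4 set). f i) = f 0 + f 1 + f 2 + f 3" for f :: "4 \<Rightarrow> 'a::comm_monoid_add"
proof -
  have "(4::4) = 0"
    by simp
  then have "f 4 = f 0"
    by (rule arg_cong)
  then show ?thesis
    by (simp only: sum_4 ac_simps)
qed

lemma forall_4_zero: "(\<forall>i::4. P i) \<longleftrightarrow> P 0 \<and> P 1 \<and> P 2 \<and> P 3"
proof -
  have "(4::4) = 0"
    by simp
  then show ?thesis
    using forall_4[of P] by metis
qed

lemma mprod_components: "mprod x y = x $ 0 * y $ 0 - x $ 1 * y $ 1 - x $ 2 * y $ 2 - x $ 3 * y $ 3"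
  by (simp add: mprod_def minkowski_vector inner_vec_def sum_4_zero)

lemma mprod_commute: "mprod x y = mprod y x"
  by (simp add: mprod_components algebra_simps)

lemma mprod_simps [simp]:
  "mprod (x + y) z = mprod x z + mprod y z"
  "mprod z (x + y) = mprod z x + mprod z y"
  "mprod (x - y) z = mprod x z - mprod y z"
  "mprod z (x - y) = mprod z x - mprod z y"
  "mprod (a *\<^sub>R x) z = a * mprod x z"
  "mprod z (a *\<^sub>R x) = a * mprod z x"
  "mprod (- x) z = - mprod x z"
  "mprod z (- x) = - mprod z x"
  "mprod 0 z = 0"
  "mprod z 0 = 0"
  by (simp_all add: mprod_components algebra_simps)

lemma mprod_sum_left: "mprod (\<Sum>i\<in>I. f i) z = (\<Sum>i\<in>I. mprod (f i) z)"
  by (simp add: mprod_def inner_sum_left)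

lemma mprod_sum_right: "mprod z (\<Sum>i\<in>I. f i) = (\<Sum>i\<in>I. mprod z (f i))"
  using mprod_sum_left mprod_commute by (metis (mono_tags, lifting) sum.cong)

lemma minkowski_minkowski [simp]: "minkowski *v (minkowski *v x) = x"
  by (simp add: minkowski_self_inverse matrix_vector_mul_assoc)

lemma mprod_minkowski: "mprod x (minkowski *v y) = x \<bullet> y"
  by (simp add: mprod_def)

text \<open>Nondegeneracy: testing against \<open>minkowski *v (x - z)\<close> turns the product
  into the Euclidean square of \<open>x - z\<close>.\<close>

lemma mprod_cancel: "x = z" if "\<And>y. mprod x y = mprod z y"
proof -
  have "mprod (x - z) (minkowski *v (x - z)) = 0"
    using that by simp
  then show ?thesis
    unfolding mprod_minkowski by simp
qed

section \<open>The forward lightcone, its interior and its null vectors\<close>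

lemma continuous_on_mprod [continuous_intros]:
  "continuous_on S f \<Longrightarrow> continuous_on S h \<Longrightarrow> continuous_on S (\<lambda>x. mprod (f x) (h x))"
  unfolding mprod_components by (intro continuous_intros)

lemma forward_lightcone_iff: "r \<in> forward_lightcone \<longleftrightarrow> r $ 0 \<ge> 0 \<and> mprod r r \<ge> 0"
  by (simp add: forward_lightcone_def mprod_components power2_eq_square)

lemma interior_forward_lightcone:
  "r \<in> interior forward_lightcone \<longleftrightarrow> r $ 0 > 0 \<and> mprod r r > 0"
proof
  assume r: "r $ 0 > 0 \<and> mprod r r > 0"
  have "open ({r. r $ 0 > (0::real)} \<inter> {r. mprod r r > 0})"
    by (intro open_Int open_Collect_less continuous_intros)
  moreover have "{r. r $ 0 > 0} \<inter> {r. mprod r r > 0} \<subseteq> forward_lightcone"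
    by (auto simp: forward_lightcone_iff)
  ultimately show "r \<in> interior forward_lightcone"
    using r by (auto simp: interior_def)
next
  assume r: "r \<in> interior forward_lightcone"
  then obtain e where e: "e > 0" "cball r e \<subseteq> forward_lightcone"
    by (auto simp: mem_interior_cball)
  \<comment> \<open>Moving \<open>r\<close> back in time by \<open>e\<close> stays in the ball. The
    cone inequalities at \<open>?s\<close> then give \<open>r $ 0 \<ge> e\<close> and a strictly
    positive lower bound for \<open>mprod r r\<close>.\<close>
  let ?s = "r - e *\<^sub>R axis 0 1"
  have "?s \<in> cball r e"
    using e by (simp add: dist_norm)
  then have s: "?s $ 0 \<ge> 0" "mprod ?s ?s \<ge> 0"
    using e forward_lightcone_iff by blast+
  have "r $ 0 \<ge> e"
    using s(1) by (simp add: axis_def)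
  moreover have "mprod ?s ?s = mprod r r - e * (2 * r $ 0 - e)"
    by (simp add: mprod_components axis_def algebra_simps)
  ultimately show "r $ 0 > 0 \<and> mprod r r > 0"
    using s(2) e(1) by (smt (verit) mult_pos_pos)
qed

text \<open>A quadratic form that vanishes on the forward null cone is determined up to a factor: test it
  on \<open>(1, \<plusminus>e\<^sub>i)\<close> and on the Pythagorean null vectors \<open>(5, 3e\<^sub>i + 4e\<^sub>j)\<close>.\<close>

lemma null_preserving_conformal:
  assumes "linear T"
    and null: "\<And>x. x $ 0 \<ge> 0 \<Longrightarrow> mprod x x = 0 \<Longrightarrow> mprod (T x) (T x) = 0"
  obtains c where "\<And>x y. mprod (T x) (T y) = c * mprod x y"
proof -
  interpret T: linear T by fact
  define b where "b i j = mprod (T (axis i 1)) (T (axis j 1))" for i j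
  have b_sym: "b i j = b j i" for i j
    by (simp add: b_def mprod_commute)
  have T_eq: "T x = x $ 0 *\<^sub>R T (axis 0 1) + x $ 1 *\<^sub>R T (axis 1 1) + x $ 2 *\<^sub>R T (axis 2 1) + x $ 3 *\<^sub>R T (axis 3 1)" for x
  proof -
    have "x = x $ 0 *\<^sub>R axis 0 1 + x $ 1 *\<^sub>R axis 1 1 + x $ 2 *\<^sub>R axis 2 1 + x $ 3 *\<^sub>R axis 3 1"
      by (simp add: vec_eq_iff forall_4_zero axis_def)
    then show ?thesis
      by (metis T.add T.scaleR)
  qed
  have form: "mprod (T x) (T y) =
      x $ 0 * (y $ 0 * b 0 0 + y $ 1 * b 0 1 + y $ 2 * b 0 2 + y $ 3 * b 0 3) +
      x $ 1 * (y $ 0 * b 0 1 + y $ 1 * b 1 1 + y $ 2 * b 1 2 + y $ 3 * b 1 3) +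
      x $ 2 * (y $ 0 * b 0 2 + y $ 1 * b 1 2 + y $ 2 * b 2 2 + y $ 3 * b 2 3) +
      x $ 3 * (y $ 0 * b 0 3 + y $ 1 * b 1 3 + y $ 2 * b 2 3 + y $ 3 * b 3 3)" for x y
    using b_sym[of 1 0] b_sym[of 2 0] b_sym[of 3 0] b_sym[of 2 1] b_sym[of 3 1] b_sym[of 3 2]
    by (subst T_eq[of x], subst T_eq[of y]) (simp add: b_def[symmetric] algebra_simps)
  have *: "p * (p * b 0 0 + q * b 0 1 + s * b 0 2 + t * b 0 3) +
      q * (p * b 0 1 + q * b 1 1 + s * b 1 2 + t * b 1 3) +
      s * (p * b 0 2 + q * b 1 2 + s * b 2 2 + t * b 2 3) +
      t * (p * b 0 3 + q * b 1 3 + s * b 2 3 + t * b 3 3) = 0"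
    if "p \<ge> 0" "p * p = q * q + s * s + t * t" for p q s t
  proof -
    let ?x = "\<chi> i. if i = 0 then p else if i = 1 then q else if i = 2 then s else t"
    have "mprod (T ?x) (T ?x) = 0"
      using that by (intro null) (simp_all add: mprod_components)
    then show ?thesis
      by (simp add: form)
  qed
  have b0: "b 0 1 = 0" "b 0 2 = 0" "b 0 3 = 0" "b 1 1 = - b 0 0" "b 2 2 = - b 0 0" "b 3 3 = - b 0 0"
    using *[of 1 1 0 0] *[of 1 "-1" 0 0] *[of 1 0 1 0] *[of 1 0 "-1" 0] *[of 1 0 0 1] *[of 1 0 0 "-1"]
    by auto
  have "b 1 2 = 0" "b 1 3 = 0" "b 2 3 = 0"
    using *[of 5 3 4 0] *[of 5 3 0 4] *[of 5 0 3 4] by (simp_all add: b0)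
  then have "mprod (T x) (T y) = b 0 0 * mprod x y" for x y
    by (simp add: form b0 mprod_components[of x] algebra_simps)
  then show thesis
    using that by blast
qed

text \<open>Variational argument: on \<open>R\<close> the product is negative definite, so the
  Rayleigh quotient of \<open>A\<close> is continuous on the compact unit sphere of
  \<open>R\<close>, and a maximiser is an eigenvector.\<close>

lemma self_adjoint_eigenvector:
  assumes "subspace R" "R \<noteq> {0}" and neg: "\<And>x. x \<in> R \<Longrightarrow> x \<noteq> 0 \<Longrightarrow> mprod x x < 0"
    and "linear A" and inv: "\<And>x. x \<in> R \<Longrightarrow> A x \<in> R"
    and adj: "\<And>x y. mprod (A x) y = mprod x (A y)"
  obtains e l where "e \<in> R" "e \<noteq> 0" "A e = l *\<^sub>R e"
proof -
  interpret A: linear A by fact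
  obtain w where w: "w \<in> R" "w \<noteq> 0"
    using assms(1,2) subspace_0 by blast
  define S where "S = R \<inter> sphere 0 1"
  have S: "x \<in> R \<and> x \<noteq> 0" if "x \<in> S" for x
    using that by (auto simp: S_def)
  have scaled: "(1 / norm x) *\<^sub>R x \<in> S" if "x \<in> R" "x \<noteq> 0" for x
    using that assms(1) by (simp add: S_def subspace_scale)
  have "compact S"
    unfolding S_def using closed_subspace[OF assms(1)] by (simp add: closed_Int_compact)
  moreover have "S \<noteq> {}"
    using scaled[OF w] by auto
  moreover have cont: "continuous_on S (\<lambda>x. mprod x (A x) / mprod x x)"
  proof (intro continuous_intros ballI)
    show "continuous_on S A"
      using \<open>linear A\<close> by (simp add: linear_continuous_on linear_conv_bounded_linear)
    show "mprod x x \<noteq> 0" if "x \<in> S" for x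
      using S[OF that] neg by fastforce
  qed
  ultimately obtain e where e: "e \<in> S"
    and max: "\<And>x. x \<in> S \<Longrightarrow> mprod x (A x) / mprod x x \<le> mprod e (A e) / mprod e e"
    using continuous_attains_sup[OF _ _ cont] by metis
  define l where "l = mprod e (A e) / mprod e e"
  have eR: "e \<in> R" "e \<noteq> 0"
    using S e by auto
  \<comment> \<open>Multiplying by the negative number \<open>mprod x x\<close> reverses the
    maximality inequality, so \<open>F\<close> is positive semidefinite on \<open>R\<close> with
    \<open>F e e = 0\<close>.\<close>
  define F where "F x y = mprod x (A y - l *\<^sub>R y)" for x y
  have F_nonneg: "F x x \<ge> 0" if "x \<in> R" for x
  proof (cases "x = 0")
    case False
    have "mprod x (A x) / mprod x x \<le> l"
      using max[OF scaled[OF that False]] False by (simp add: A.scaleR l_def)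
    then show ?thesis
      using neg[OF that False] by (simp add: F_def field_simps)
  qed (simp add: F_def)
  have "F e e = 0"
    using neg[OF eR] by (simp add: F_def l_def)
  \<comment> \<open>Vary \<open>e\<close> along the residual of the eigenvalue equation:
    \<open>F y e = mprod y y\<close>, and definiteness makes the residual vanish once this number
    does.\<close>
  define y where "y = A e - l *\<^sub>R e"
  have yR: "y \<in> R"
    unfolding y_def using assms(1) eR inv by (simp add: subspace_diff subspace_scale)
  have F_expand: "F (e + t *\<^sub>R y) (e + t *\<^sub>R y) = 2 * t * F y e + t\<^sup>2 * F y y" for t
    using \<open>F e e = 0\<close> adj[of e y] mprod_commute[of y "A e"] mprod_commute[of e y]
    by (simp add: F_def A.add A.scaleR power2_eq_square algebra_simps)
  have nonneg: "2 * t * F y e + t\<^sup>2 * F y y \<ge> 0" for t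
    unfolding F_expand[symmetric] using assms(1) eR yR
    by (intro F_nonneg) (simp add: subspace_add subspace_scale)
  have "F y e = 0"
  proof (rule ccontr)
    assume "F y e \<noteq> 0"
    have "F y e = mprod y y"
      by (simp add: F_def y_def)
    with \<open>F y e \<noteq> 0\<close> have *: "F y e < 0"
      using neg[OF yR] by fastforce
    \<comment> \<open>A small positive step for which the quadratic term cancels at most half of the
      negative linear term. The summand 1 keeps the denominator positive when
      \<open>F y y = 0\<close>.\<close>
    let ?t = "- F y e / (F y y + 1)"
    have **: "F y y + 1 > 0"
      using F_nonneg[OF yR] by simp
    have "?t > 0"
      using * ** by (simp add: divide_neg_pos)
    moreover have "2 * ?t * F y e + ?t\<^sup>2 * F y y = ?t * (2 * F y e + ?t * F y y)"
      by (simp add: power2_eq_square algebra_simps)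
    moreover have "?t * F y y \<le> - F y e"
      using * ** F_nonneg[OF yR] by (simp add: field_simps)
    ultimately show False
      using nonneg[of ?t] * by (smt (verit) mult_pos_neg)
  qed
  then have "mprod y y = 0"
    by (simp add: F_def y_def)
  then have "y = 0"
    using neg[OF yR] by force
  then have "A e = l *\<^sub>R e"
    by (simp add: y_def)
  then show thesis
    by (rule that[OF eR])
qed

section \<open>Symmetries as isometries commuting with \<open>\<Lambda>\<close>\<close>

locale higgs_parameters =
  fixes \<Lambda> :: "real^4^4" and M K :: "real^4"
  assumes \<Lambda>_symmetric: "transpose \<Lambda> = \<Lambda>"
    and K_interior: "raise_index K \<in> interior forward_lightcone"
    and K_unit: "linear_form K (raise_index K) = 1"
begin

text \<open>The mixed tensor with one index raised. Its ordinary eigenvectors are the Minkowski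
  eigenvectors of \<open>\<Lambda>\<close>, and symmetry of \<open>\<Lambda>\<close> becomes
  self-adjointness for \<open>mprod\<close>.\<close>

definition A :: "real^4 \<Rightarrow> real^4" where
  "A x = minkowski *v (\<Lambda> *v x)"

definition k :: "real^4" where
  "k = minkowski *v K"

lemma linear_A: "linear A"
  unfolding A_def by (simp add: linear_iff matrix_vector_right_distrib matrix_vector_mult_scaleR)

lemma quadratic_form_A: "quadratic_form \<Lambda> x = mprod x (A x)"
  by (simp add: A_def quadratic_form_def mprod_minkowski)

lemma A_self_adjoint: "mprod (A x) y = mprod x (A y)"
proof -
  have "mprod (A x) y = (transpose \<Lambda> *v x) \<bullet> y"
    unfolding mprod_commute[of "A x"] \<Lambda>_symmetric
    by (simp add: A_def mprod_minkowski inner_commute)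
  also have "\<dots> = x \<bullet> (\<Lambda> *v y)"
    by (simp add: transpose_matrix_vector dot_lmul_matrix)
  finally show ?thesis
    by (simp add: A_def mprod_minkowski)
qed

lemma minkowski_eigenvector_A: "minkowski_eigenvector \<Lambda> e \<longleftrightarrow> e \<noteq> 0 \<and> (\<exists>l. A e = l *\<^sub>R e)"
proof -
  have "\<Lambda> *v e = l *\<^sub>R (minkowski *v e) \<longleftrightarrow> A e = l *\<^sub>R e" for l
    unfolding A_def by (metis minkowski_minkowski matrix_vector_mult_scaleR)
  then show ?thesis
    by (simp add: minkowski_eigenvector_def)
qed

lemma mprod_k: "mprod k x = K \<bullet> x"
  by (simp add: k_def mprod_commute[of _ x] mprod_minkowski inner_commute)

lemma k_timelike: "k $ 0 > 0" "mprod k k = 1"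
proof -
  have "raise_index K = k"
    by (simp add: raise_index_def k_def matrix_inv_minkowski)
  then show "k $ 0 > 0" "mprod k k = 1"
    using K_interior K_unit by (simp_all add: interior_forward_lightcone mprod_k linear_form_def)
qed

text \<open>The left side is the square of the Euclidean product of the spatial parts of
  \<open>k\<close> and \<open>x\<close>. The spatial square of \<open>k\<close> is
  \<open>(k $ 0)\<^sup>2 - 1\<close>, and that of a causal \<open>x\<close> is at most
  \<open>(x $ 0)\<^sup>2\<close>.\<close>

lemma timelike_Cauchy_Schwarz:
  assumes "mprod x x \<ge> 0"
  shows "(k $ 0 * x $ 0 - K \<bullet> x)\<^sup>2 \<le> ((k $ 0)\<^sup>2 - 1) * (x $ 0)\<^sup>2"
proof -
  have "(k $ 0 * x $ 0 - K \<bullet> x)\<^sup>2 = (k $ 1 * x $ 1 + k $ 2 * x $ 2 + k $ 3 * x $ 3)\<^sup>2"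
    by (simp add: mprod_components add.assoc flip: mprod_k)
  also have "\<dots> \<le> ((k $ 1)\<^sup>2 + (k $ 2)\<^sup>2 + (k $ 3)\<^sup>2) * ((x $ 1)\<^sup>2 + (x $ 2)\<^sup>2 + (x $ 3)\<^sup>2)"
  proof -
    \<comment> \<open>Lagrange's identity: the defect in Cauchy-Schwarz is the squared cross
      product.\<close>
    have "((k $ 1)\<^sup>2 + (k $ 2)\<^sup>2 + (k $ 3)\<^sup>2) * ((x $ 1)\<^sup>2 + (x $ 2)\<^sup>2 + (x $ 3)\<^sup>2)
        = (k $ 1 * x $ 1 + k $ 2 * x $ 2 + k $ 3 * x $ 3)\<^sup>2 + (k $ 1 * x $ 2 - k $ 2 * x $ 1)\<^sup>2
          + (k $ 1 * x $ 3 - k $ 3 * x $ 1)\<^sup>2 + (k $ 2 * x $ 3 - k $ 3 * x $ 2)\<^sup>2"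
      by (simp add: power2_eq_square algebra_simps)
    then show ?thesis
      by simp
  qed
  also have "\<dots> \<le> ((k $ 1)\<^sup>2 + (k $ 2)\<^sup>2 + (k $ 3)\<^sup>2) * (x $ 0)\<^sup>2"
    using assms by (intro mult_left_mono) (simp_all add: mprod_components power2_eq_square)
  also have "(k $ 1)\<^sup>2 + (k $ 2)\<^sup>2 + (k $ 3)\<^sup>2 = (k $ 0)\<^sup>2 - 1"
    using k_timelike(2) by (simp add: mprod_components power2_eq_square)
  finally show ?thesis .
qed

text \<open>For causal \<open>x\<close> with \<open>K \<bullet> x = 0\<close> the preceding bound
  leaves \<open>(x $ 0)\<^sup>2 \<le> 0\<close>, and then the spatial part vanishes too. Thus
  \<open>- mprod\<close> is a Euclidean product on the kernel of \<open>K\<close>.\<close>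

lemma orthogonal_K_spacelike:
  assumes "K \<bullet> x = 0" "x \<noteq> 0"
  shows "mprod x x < 0"
proof (rule ccontr)
  assume "\<not> mprod x x < 0"
  then have x: "mprod x x \<ge> 0"
    by simp
  then have "(x $ 0)\<^sup>2 \<le> 0"
    using timelike_Cauchy_Schwarz[OF x] assms(1) by (simp add: power_mult_distrib algebra_simps)
  then have "x $ 0 = 0"
    by simp
  then have "x $ 1 * x $ 1 + x $ 2 * x $ 2 + x $ 3 * x $ 3 \<le> 0"
    using x by (simp add: mprod_components)
  then have "x $ 1 = 0" "x $ 2 = 0" "x $ 3 = 0"
    by (smt (verit) mult_eq_0_iff zero_le_square)+
  then have "x = 0"
    using \<open>x $ 0 = 0\<close> by (simp add: vec_eq_iff forall_4_zero)
  then show False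
    using assms(2) by simp
qed

text \<open>Replaces the sign of the time component by the sign of \<open>K \<bullet> x\<close>. The
  cone is then described by quantities that an isometry fixing \<open>K\<close> preserves.\<close>

lemma forward_lightcone_K: "x \<in> forward_lightcone \<longleftrightarrow> mprod x x \<ge> 0 \<and> K \<bullet> x \<ge> 0"
proof -
  have K_nonneg: "K \<bullet> x \<ge> 0" if "x $ 0 \<ge> 0" "mprod x x \<ge> 0" for x
  proof -
    have "(k $ 0 * x $ 0 - K \<bullet> x)\<^sup>2 \<le> (k $ 0 * x $ 0)\<^sup>2"
      using timelike_Cauchy_Schwarz[OF that(2)] zero_le_power2[of "x $ 0"]
      unfolding power_mult_distrib left_diff_distrib by linarith
    then have "k $ 0 * x $ 0 - K \<bullet> x \<le> k $ 0 * x $ 0 \<or> k $ 0 * x $ 0 < 0"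
      by (meson not_less power2_le_imp_le)
    moreover have "k $ 0 * x $ 0 \<ge> 0"
      using k_timelike(1) that(1) by simp
    ultimately show ?thesis
      by simp
  qed
  \<comment> \<open>If \<open>x $ 0 < 0\<close>, the first part applied to \<open>- x\<close> forces
    \<open>K \<bullet> x = 0\<close>, which no nonzero causal vector satisfies.\<close>
  have "x $ 0 \<ge> 0" if x: "mprod x x \<ge> 0" "K \<bullet> x \<ge> 0"
  proof (rule ccontr)
    assume "\<not> x $ 0 \<ge> 0"
    then have "K \<bullet> (- x) \<ge> 0" "x \<noteq> 0"
      using x(1) \<open>\<not> x $ 0 \<ge> 0\<close> K_nonneg[of "- x"] by auto
    then show False
      using x orthogonal_K_spacelike[of x] by simp
  qed
  then show ?thesis
    using K_nonneg by (auto simp: forward_lightcone_iff)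
qed

text \<open>Trades the cone condition for algebraic identities. In the converse direction,
  nondegeneracy and finite dimension give bijectivity, and cone membership depends only on
  \<open>mprod x x\<close> and \<open>K \<bullet> x\<close>.\<close>

lemma explicit_symmetry_iff:
  "explicit_symmetry \<Lambda> M K T \<longleftrightarrow>
     linear T \<and> (\<forall>x y. mprod (T x) (T y) = mprod x y) \<and> (\<forall>x. A (T x) = T (A x)) \<and>
     (\<forall>x. M \<bullet> T x = M \<bullet> x) \<and> (\<forall>x. K \<bullet> T x = K \<bullet> x)" (is "_ \<longleftrightarrow> ?R")
proof
  assume T: "explicit_symmetry \<Lambda> M K T"
  then have lin: "linear T" and bij: "bij T" and LC: "T ` forward_lightcone = forward_lightcone"
    and quad: "\<And>x. mprod (T x) (A (T x)) = mprod x (A x)"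
    and MT: "\<And>x. M \<bullet> T x = M \<bullet> x" and KT: "\<And>x. K \<bullet> T x = K \<bullet> x"
    by (auto simp: explicit_symmetry_def quadratic_form_A linear_form_def)
  interpret T: linear T by fact
  have T_interior: "T ` interior forward_lightcone = interior forward_lightcone"
    using interior_injective_linear_image[OF lin bij_is_inj[OF bij], of forward_lightcone] LC by simp
  \<comment> \<open>A linear bijection preserving the cone carries its interior onto itself. A null
    vector sent to a vector of positive square would come from the interior, where squares are
    positive.\<close>
  have "mprod (T x) (T x) = 0" if x: "x $ 0 \<ge> 0" "mprod x x = 0" for x
  proof (rule ccontr)
    assume "mprod (T x) (T x) \<noteq> 0"
    moreover have Tx: "T x \<in> forward_lightcone"
      using LC x by (auto simp: forward_lightcone_iff)
    ultimately have pos: "mprod (T x) (T x) > 0" "T x $ 0 \<ge> 0"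
      by (auto simp: forward_lightcone_iff)
    moreover have "T x $ 0 \<noteq> 0"
    proof
      assume z: "T x $ 0 = 0"
      then show False
        using pos(1) zero_le_square[of "T x $ 1"] zero_le_square[of "T x $ 2"] zero_le_square[of "T x $ 3"]
        unfolding mprod_components z by linarith
    qed
    ultimately have "T x \<in> interior forward_lightcone"
      by (simp add: interior_forward_lightcone)
    then have "x \<in> interior forward_lightcone"
      using T_interior bij by (metis bij_is_inj inj_image_mem_iff)
    then show False
      using x by (simp add: interior_forward_lightcone)
  qed
  then obtain c where c: "\<And>x y. mprod (T x) (T y) = c * mprod x y"
    using null_preserving_conformal[OF lin] by metis
  txt \<open>\<open>K\<close> is invariant, so its dual \<open>k\<close> is an eigenvector for the conformal factor; evaluating \<open>K\<close>
    on \<open>k\<close> shows that the factor is \<open>1\<close>.\<close>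
  have "T k = c *\<^sub>R k"
  proof (rule mprod_cancel)
    fix y
    obtain x where "y = T x"
      using bij by (metis bij_pointE)
    then show "mprod (T k) y = mprod (c *\<^sub>R k) y"
      by (simp add: c mprod_k KT)
  qed
  moreover have "K \<bullet> T k = 1"
    using KT k_timelike(2) mprod_k by metis
  ultimately have "c = 1"
    using k_timelike(2) mprod_k[of k] by simp
  then have iso: "mprod (T x) (T y) = mprod x y" for x y
    by (simp add: c)
  \<comment> \<open>Polarization, valid by self-adjointness of \<open>A\<close>, upgrades invariance
    of the quadratic form to the bilinear one. Nondegeneracy and surjectivity of \<open>T\<close>
    then give commutation.\<close>
  have polar: "2 * mprod x (A y) = mprod (x + y) (A (x + y)) - mprod x (A x) - mprod y (A y)" for x y
    using A_self_adjoint[of y x] mprod_commute[of "A y" x]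
    by (simp add: linear_add[OF linear_A])
  have biform: "mprod (T x) (A (T y)) = mprod x (A y)" for x y
    using polar[of x y] polar[of "T x" "T y"] by (simp add: quad flip: T.add)
  have "A (T x) = T (A x)" for x
  proof (rule mprod_cancel)
    fix z
    obtain y where "z = T y"
      using bij by (metis bij_pointE)
    then show "mprod (A (T x)) z = mprod (T (A x)) z"
      using biform[of x y] by (simp add: iso A_self_adjoint)
  qed
  then show ?R
    using lin iso MT KT by blast
next
  assume T: ?R
  then interpret T: linear T
    by blast
  have "inj T"
  proof (rule linear_injective_0[OF T.linear_axioms, THEN iffD2], intro allI impI)
    fix x assume "T x = 0"
    then have "mprod x y = mprod 0 y" for y
      using T by (metis mprod_simps(9))
    then show "x = 0"
      by (rule mprod_cancel)
  qed
  moreover have "surj T"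
    using T.linear_axioms \<open>inj T\<close> by (rule linear_inj_imp_surj)
  ultimately have "bij T"
    by (simp add: bij_def)
  have "T x \<in> forward_lightcone \<longleftrightarrow> x \<in> forward_lightcone" for x
    using T by (simp add: forward_lightcone_K)
  then have "T ` forward_lightcone = forward_lightcone"
    using \<open>surj T\<close> by (auto simp: image_iff) (metis surjD)
  then show "explicit_symmetry \<Lambda> M K T"
    using T \<open>bij T\<close> by (simp add: explicit_symmetry_def quadratic_form_A linear_form_def)
qed

section \<open>Orthonormal systems of eigenvectors annihilated by \<open>M\<close> and
  \<open>K\<close>\<close>

definition eigenframe :: "(real^4) set \<Rightarrow> bool" where
  "eigenframe B \<longleftrightarrow> finite B \<and>
     (\<forall>b\<in>B. mprod b b = - 1 \<and> (\<exists>l. A b = l *\<^sub>R b) \<and> M \<bullet> b = 0 \<and> K \<bullet> b = 0) \<and>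
     (\<forall>b\<in>B. \<forall>b'\<in>B. b \<noteq> b' \<longrightarrow> mprod b b' = 0)"

text \<open>Pairing a linear relation with \<open>b\<close> isolates \<open>- u b\<close>, so a
  frame is independent. It lies in the hyperplane \<open>K \<bullet> x = 0\<close>, of dimension
  3.\<close>

lemma eigenframe_card:
  assumes "eigenframe B"
  shows "card B \<le> 3"
proof -
  have B: "finite B" "\<And>b. b \<in> B \<Longrightarrow> mprod b b = - 1" "\<And>b. b \<in> B \<Longrightarrow> K \<bullet> b = 0"
    "\<And>b b'. b \<in> B \<Longrightarrow> b' \<in> B \<Longrightarrow> b \<noteq> b' \<Longrightarrow> mprod b b' = 0"
    using assms by (auto simp: eigenframe_def)
  have "independent B"
    unfolding independent_explicit
  proof (intro conjI allI impI ballI)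
    fix u b assume u: "(\<Sum>v\<in>B. u v *\<^sub>R v) = 0" and b: "b \<in> B"
    have "0 = mprod (\<Sum>v\<in>B. u v *\<^sub>R v) b"
      by (simp add: u)
    also have "\<dots> = (\<Sum>v\<in>B. if v = b then - u b else 0)"
      unfolding mprod_sum_left using B b by (intro sum.cong) auto
    also have "\<dots> = - u b"
      using B(1) b by simp
    finally show "u b = 0"
      by simp
  qed (rule B(1))
  moreover have "B \<subseteq> {x. K \<bullet> x = 0}"
    using B by auto
  ultimately have "card B \<le> dim {x. K \<bullet> x = 0}"
    by (simp add: independent_card_le_dim)
  moreover have "K \<noteq> 0"
    using k_timelike(2) mprod_k[of k] by auto
  ultimately show ?thesis
    by (simp add: dim_hyperplane)
qed

lemma eigenvector_normalise:
  assumes "A e = l *\<^sub>R e" "e \<noteq> 0" "M \<bullet> e = 0" "K \<bullet> e = 0"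
  obtains f where "mprod f f = - 1" "A f = l *\<^sub>R f" "M \<bullet> f = 0" "K \<bullet> f = 0"
    "\<And>x. mprod x e = 0 \<Longrightarrow> mprod x f = 0"
proof
  let ?s = "sqrt (- mprod e e)"
  have s: "- mprod e e > 0"
    using orthogonal_K_spacelike[OF assms(4,2)] by simp
  show "mprod ((1 / ?s) *\<^sub>R e) ((1 / ?s) *\<^sub>R e) = - 1"
    using s by (simp add: divide_simps)
  show "A ((1 / ?s) *\<^sub>R e) = l *\<^sub>R ((1 / ?s) *\<^sub>R e)"
    using assms(1) by (simp add: linear_scale[OF linear_A])
qed (use assms in auto)

lemma maximal_eigenframe:
  obtains B where "eigenframe B" "\<And>C. eigenframe C \<Longrightarrow> card C \<le> card B"
proof -
  have "eigenframe {}"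
    by (simp add: eigenframe_def)
  then have "\<exists>B. eigenframe B \<and> (\<forall>C. eigenframe C \<longrightarrow> card C \<le> card B)"
    by (rule ex_has_greatest_nat[where b = 4]) (use eigenframe_card in fastforce)
  then show thesis
    using that by blast
qed

text \<open>The projection of the range of \<open>T - 1\<close> to the complement of the span of \<open>B\<close> is
  \<open>A\<close>-invariant and orthogonal to \<open>M\<close> and \<open>K\<close>. If it were nonzero, an eigenvector in it would
  extend \<open>B\<close>.\<close>

lemma symmetry_displacement_in_span:
  assumes B: "eigenframe B" and max: "\<And>C. eigenframe C \<Longrightarrow> card C \<le> card B"
    and T: "explicit_symmetry \<Lambda> M K T"
  shows "T x - x \<in> span B"
proof -
  have fin: "finite B"
    and BB: "\<And>b. b \<in> B \<Longrightarrow> mprod b b = - 1" "\<And>b b'. b \<in> B \<Longrightarrow> b' \<in> B \<Longrightarrow> b \<noteq> b' \<Longrightarrow> mprod b b' = 0"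
    and MB: "\<And>b. b \<in> B \<Longrightarrow> M \<bullet> b = 0" and KB: "\<And>b. b \<in> B \<Longrightarrow> K \<bullet> b = 0"
    and eig: "\<And>b. b \<in> B \<Longrightarrow> \<exists>l. A b = l *\<^sub>R b"
    using B by (auto simp: eigenframe_def)
  have lin: "linear T" and comm: "\<And>x. A (T x) = T (A x)"
    and MT: "\<And>x. M \<bullet> T x = M \<bullet> x" and KT: "\<And>x. K \<bullet> T x = K \<bullet> x"
    using T by (auto simp: explicit_symmetry_iff)
  \<comment> \<open>Orthogonal projection onto the span of \<open>B\<close>. The minus sign
    compensates \<open>mprod b b = - 1\<close>.\<close>
  define P where "P x = (\<Sum>b\<in>B. (- mprod x b) *\<^sub>R b)" for x
  have linear_P: "linear P"
    by (rule linearI) (simp_all add: P_def scaleR_sum_right algebra_simps flip: sum.distrib)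
  have P_span: "P x \<in> span B" for x
    unfolding P_def by (intro span_sum span_scale span_base)
  have P_mprod: "mprod (P x) b = mprod x b" if "b \<in> B" for x b
  proof -
    have "mprod (P x) b = (\<Sum>b'\<in>B. if b' = b then mprod x b else 0)"
      unfolding P_def mprod_sum_left using BB that by (intro sum.cong) auto
    then show ?thesis
      using fin that by simp
  qed
  have A_P: "A (P x) = P (A x)" for x
    unfolding P_def linear_sum[OF linear_A]
  proof (rule sum.cong)
    fix b assume "b \<in> B"
    then obtain l where "A b = l *\<^sub>R b"
      using eig by blast
    then show "A (- mprod x b *\<^sub>R b) = - mprod (A x) b *\<^sub>R b"
      by (simp add: A_self_adjoint linear_scale[OF linear_A] linear_neg[OF linear_A])
  qed simp
  \<comment> \<open>The part of \<open>T - 1\<close> orthogonal to \<open>B\<close>. It commutes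
    with \<open>A\<close> because both \<open>T\<close> and \<open>P\<close> do, so its range is
    \<open>A\<close>-invariant.\<close>
  define D where "D x = (T x - x) - P (T x - x)" for x
  have linear_D: "linear D"
    unfolding D_def
    by (intro linear_compose_sub linear_compose[OF _ linear_P, unfolded o_def] lin linear_ident)
  have A_D: "A (D x) = D (A x)" for x
    by (simp add: D_def comm linear_diff[OF linear_A] A_P)
  have D_orth: "mprod (D x) b = 0" if "b \<in> B" for x b
    by (simp add: D_def P_mprod that)
  have D_M: "M \<bullet> D x = 0" and D_K: "K \<bullet> D x = 0" for x
    by (simp_all add: D_def P_def inner_diff_right inner_sum_right MB KB MT KT)
  have "range D = {0}"
  proof (rule ccontr)
    assume "range D \<noteq> {0}"
    moreover have "subspace (range D)"
      using linear_D by (simp add: linear_subspace_image)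
    moreover have "A y \<in> range D" if "y \<in> range D" for y
      using that A_D by auto
    moreover have "mprod y y < 0" if "y \<in> range D" "y \<noteq> 0" for y
      using that D_K by (intro orthogonal_K_spacelike) auto
    ultimately obtain e l where e: "e \<in> range D" "e \<noteq> 0" "A e = l *\<^sub>R e"
      using self_adjoint_eigenvector[of "range D" A] linear_A A_self_adjoint by metis
    then have "M \<bullet> e = 0" "K \<bullet> e = 0" and orth: "\<And>b. b \<in> B \<Longrightarrow> mprod b e = 0"
      using D_M D_K D_orth mprod_commute by auto
    then obtain f where f: "mprod f f = - 1" "A f = l *\<^sub>R f" "M \<bullet> f = 0" "K \<bullet> f = 0"
      "\<And>b. b \<in> B \<Longrightarrow> mprod b f = 0"
      using eigenvector_normalise[OF e(3,2)] by metis
    then have "eigenframe (insert f B)"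
      using B mprod_commute by (auto simp: eigenframe_def)
    \<comment> \<open>Membership would give \<open>mprod f f = 0\<close> instead of
      \<open>- 1\<close>, so inserting \<open>f\<close> strictly enlarges the frame.\<close>
    moreover have "f \<notin> B"
      using f(1,5) by force
    ultimately show False
      using max[of "insert f B"] fin by simp
  qed
  then have "D x = 0"
    by blast
  then show ?thesis
    using P_span[of "T x - x"] by (simp add: D_def)
qed

end

section \<open>Orthogonal matrices commuting with a diagonal matrix\<close>

text \<open>The entrywise condition says that \<open>Q\<close> commutes with the diagonal matrix of
  \<open>l\<close>, since the two products have entries \<open>l i * Q $ i $ j\<close> and
  \<open>Q $ i $ j * l j\<close>.\<close>

definition diagonal_centralizer :: "('n \<Rightarrow> real) \<Rightarrow> (real^'n^'n) monoid" where
  "diagonal_centralizer l =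
     \<lparr>carrier = {Q. orthogonal_matrix Q \<and> (\<forall>i j. Q $ i $ j \<noteq> 0 \<longrightarrow> l i = l j)},
      mult = (**), one = mat 1\<rparr>"

lemma orthogonal_matrix_inner:
  fixes Q :: "real^'n^'n"
  shows "orthogonal_matrix Q \<longleftrightarrow> (\<forall>x y. (Q *v x) \<bullet> (Q *v y) = x \<bullet> y)"
  using orthogonal_transformation_matrix[of "(*v) Q"]
  by (simp add: orthogonal_transformation_def matrix_vector_mul_linear matrix_of_matrix_vector_mul)

definition sign_of :: "int \<Rightarrow> real" where
  "sign_of a = (if a = 0 then 1 else - 1)"

definition diag :: "('n \<Rightarrow> real) \<Rightarrow> real^'n^'n" where
  "diag f = (\<chi> i j. if i = j then f i else 0)"

lemma diag_mult: "diag f ** diag g = diag (\<lambda>i. f i * g i)"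
proof -
  have "(\<Sum>k\<in>UNIV. (if i = k then f i else 0) * (if k = j then g k else 0))
      = (\<Sum>k\<in>UNIV. if k = i then (if i = j then f i * g i else 0) else 0)" for i j
    by (rule sum.cong) auto
  then show ?thesis
    by (simp add: diag_def matrix_matrix_mult_def vec_eq_iff)
qed

lemma orthogonal_matrix_diag: "orthogonal_matrix (diag f) \<longleftrightarrow> (\<forall>i. f i = 1 \<or> f i = - 1)"
proof -
  have "transpose (diag f) = diag f"
    by (simp add: transpose_def diag_def vec_eq_iff)
  then have "orthogonal_matrix (diag f) \<longleftrightarrow> diag (\<lambda>i. f i * f i) = mat 1"
    by (simp add: orthogonal_matrix diag_mult)
  also have "\<dots> \<longleftrightarrow> (\<forall>i. f i * f i = 1)"
    by (auto simp: diag_def mat_def vec_eq_iff)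
  finally show ?thesis
    by (simp add: square_eq_1_iff)
qed

lemma diag_nth: "diag f $ i $ j = (if i = j then f i else 0)"
  by (simp add: diag_def)

lemma inj_diag: "inj diag"
proof (rule injI, rule ext)
  fix f g i
  assume "diag f = diag g"
  then have "diag f $ i $ i = diag g $ i $ i"
    by simp
  then show "f i = g i"
    by (simp add: diag_nth)
qed

text \<open>Distinct eigenvalues kill every off-diagonal entry, and orthogonality leaves only signs
  on the diagonal.\<close>

lemma diagonal_centralizer_inj:
  assumes "inj l"
  shows "carrier (diagonal_centralizer l) = diag ` {f. \<forall>i. f i = 1 \<or> f i = - 1}" (is "?L = ?R")
proof
  show "?L \<subseteq> ?R"
  proof
    fix Q assume Q: "Q \<in> ?L"
    then have "Q $ i $ j = 0" if "i \<noteq> j" for i j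
      using assms that by (auto simp: diagonal_centralizer_def inj_eq)
    then have diag: "Q = diag (\<lambda>i. Q $ i $ i)"
      by (simp add: diag_nth vec_eq_iff)
    moreover have "orthogonal_matrix Q"
      using Q by (simp add: diagonal_centralizer_def)
    then have "orthogonal_matrix (diag (\<lambda>i. Q $ i $ i))"
      by (subst (asm) diag)
    then have "\<forall>i. Q $ i $ i = 1 \<or> Q $ i $ i = - 1"
      unfolding orthogonal_matrix_diag .
    ultimately show "Q \<in> ?R"
      by (intro image_eqI[of Q diag "\<lambda>i. Q $ i $ i"]) simp_all
  qed
  show "?R \<subseteq> ?L"
    by (auto simp: diagonal_centralizer_def orthogonal_matrix_diag diag_nth
        split: if_splits)
qed

text \<open>Reduces the elementary abelian cases to a pointwise multiplicative parametrization
  \<open>F\<close> of sign functions.\<close>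

lemma diagonal_centralizer_inj_iso:
  fixes l :: "'n::finite \<Rightarrow> real" and F :: "'a \<Rightarrow> 'n \<Rightarrow> real"
  assumes "inj l" and bij: "bij_betw F (carrier G) {f. \<forall>i. f i = 1 \<or> f i = - 1}"
    and mult: "\<And>x y i. x \<in> carrier G \<Longrightarrow> y \<in> carrier G \<Longrightarrow> F (x \<otimes>\<^bsub>G\<^esub> y) i = F x i * F y i"
  shows "G \<cong> diagonal_centralizer l"
proof (rule is_isoI, rule isoI)
  have "bij_betw diag {f. \<forall>i. f i = 1 \<or> f i = - 1} (carrier (diagonal_centralizer l))"
    unfolding bij_betw_def diagonal_centralizer_inj[OF assms(1)]
    using inj_on_subset[OF inj_diag subset_UNIV] by blast
  then show bij': "bij_betw (diag \<circ> F) (carrier G) (carrier (diagonal_centralizer l))"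
    using bij bij_betw_trans by blast
  show "diag \<circ> F \<in> hom G (diagonal_centralizer l)"
  proof (rule homI)
    show "(diag \<circ> F) x \<in> carrier (diagonal_centralizer l)" if "x \<in> carrier G" for x
      using bij' that by (rule bij_betwE[THEN bspec])
  next
    have "F (x \<otimes>\<^bsub>G\<^esub> y) = (\<lambda>i. F x i * F y i)" if "x \<in> carrier G" "y \<in> carrier G" for x y
      using mult[OF that] by (rule ext)
    then show "(diag \<circ> F) (x \<otimes>\<^bsub>G\<^esub> y) = (diag \<circ> F) x \<otimes>\<^bsub>diagonal_centralizer l\<^esub> (diag \<circ> F) y"
      if "x \<in> carrier G" "y \<in> carrier G" for x y
      using that by (simp add: diagonal_centralizer_def diag_mult)
  qed
qed

section \<open>Powers of \<open>Z2\<close> as centralizers for distinct eigenvalues\<close>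

lemma carrier_Z2: "a \<in> carrier Z2 \<longleftrightarrow> a = 0 \<or> a = 1"
  by (auto simp: carrier_integer_mod_group)

lemma sign_of_mult:
  "a \<in> carrier Z2 \<Longrightarrow> b \<in> carrier Z2 \<Longrightarrow> sign_of ((a + b) mod 2) = sign_of a * sign_of b"
  by (auto simp: carrier_Z2 sign_of_def)

lemma Z2_iso:
  fixes l :: "1 \<Rightarrow> real"
  shows "Z2 \<cong> diagonal_centralizer l"
proof (rule diagonal_centralizer_inj_iso)
  show "inj l"
    by (simp add: inj_def)
  show "bij_betw (\<lambda>a i. sign_of a) (carrier Z2) {f :: 1 \<Rightarrow> real. \<forall>i. f i = 1 \<or> f i = - 1}"
    by (rule bij_betw_byWitness[where f' = "\<lambda>f. if f 1 = 1 then 0 else 1"])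
      (auto simp: carrier_Z2 sign_of_def fun_eq_iff)
qed (simp add: sign_of_mult mult_integer_mod_group)

lemma Z2_Z2_iso:
  fixes l :: "2 \<Rightarrow> real"
  assumes "l 1 \<noteq> l 2"
  shows "Z2 \<times>\<times> Z2 \<cong> diagonal_centralizer l"
proof (rule diagonal_centralizer_inj_iso)
  show "inj l"
    using assms by (auto simp: inj_def forall_2)
  show "bij_betw (\<lambda>(a, b) i. if i = 1 then sign_of a else sign_of b) (carrier (Z2 \<times>\<times> Z2))
      {f :: 2 \<Rightarrow> real. \<forall>i. f i = 1 \<or> f i = - 1}"
    by (rule bij_betw_byWitness[where f' = "\<lambda>f. (if f 1 = 1 then 0 else 1, if f 2 = 1 then 0 else 1)"])
      (auto simp: carrier_Z2 sign_of_def fun_eq_iff forall_2)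
qed (auto simp: sign_of_mult mult_integer_mod_group)

lemma Z2_Z2_Z2_iso:
  fixes l :: "3 \<Rightarrow> real"
  assumes "l 1 \<noteq> l 2" "l 1 \<noteq> l 3" "l 2 \<noteq> l 3"
  shows "Z2 \<times>\<times> Z2 \<times>\<times> Z2 \<cong> diagonal_centralizer l"
proof (rule diagonal_centralizer_inj_iso)
  show "inj l"
    using assms by (auto simp: inj_def forall_3)
  show "bij_betw (\<lambda>(a, b, c) i. if i = 1 then sign_of a else if i = 2 then sign_of b else sign_of c)
      (carrier (Z2 \<times>\<times> Z2 \<times>\<times> Z2)) {f :: 3 \<Rightarrow> real. \<forall>i. f i = 1 \<or> f i = - 1}"
    by (rule bij_betw_byWitness[where f' =
          "\<lambda>f. (if f 1 = 1 then 0 else 1, if f 2 = 1 then 0 else 1, if f 3 = 1 then 0 else 1)"])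
      (auto simp: carrier_Z2 sign_of_def fun_eq_iff forall_3)
qed (auto simp: sign_of_mult mult_integer_mod_group)

section \<open>Centralizers for repeated eigenvalues\<close>

lemma diagonal_centralizer_const:
  fixes l :: "'n::finite \<Rightarrow> real"
  assumes "\<And>i j. l i = l j"
  shows "diagonal_centralizer l = orthogonal_group"
proof -
  have "(\<forall>i j. Q $ i $ j \<noteq> 0 \<longrightarrow> l i = l j) \<longleftrightarrow> True" for Q :: "real^'n^'n"
    using assms by blast
  then show ?thesis
    unfolding diagonal_centralizer_def orthogonal_group_def by simp
qed

definition block_sum :: "real^2^2 \<Rightarrow> real \<Rightarrow> real^3^3" where
  "block_sum P s = vector [vector [P $ 1 $ 1, P $ 1 $ 2, 0], vector [P $ 2 $ 1, P $ 2 $ 2, 0], vector [0, 0, s]]"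

definition upper_block :: "real^3^3 \<Rightarrow> real^2^2" where
  "upper_block Q = vector [vector [Q $ 1 $ 1, Q $ 1 $ 2], vector [Q $ 2 $ 1, Q $ 2 $ 2]]"

lemma block_sum_mult: "block_sum P s ** block_sum P' s' = block_sum (P ** P') (s * s')"
  by (simp add: block_sum_def matrix_matrix_mult_def vec_eq_iff forall_3 sum_3 sum_2 vector_def)

lemma orthogonal_matrix_block_sum:
  "orthogonal_matrix (block_sum P s) \<longleftrightarrow> orthogonal_matrix P \<and> s * s = 1"
  by (auto simp: orthogonal_matrix block_sum_def transpose_def mat_def matrix_matrix_mult_def
      vec_eq_iff forall_3 forall_2 sum_3 sum_2)

text \<open>The third eigenvalue differs from the first two, so all entries linking index 3 to the
  others vanish. Orthogonality then splits into an orthogonal upper block and a corner entry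
  \<open>1\<close> or \<open>- 1\<close>.\<close>

lemma O2_Z2_iso:
  fixes l :: "3 \<Rightarrow> real"
  assumes l: "l 1 = l 2" "l 1 \<noteq> l 3"
  shows "O2 \<times>\<times> Z2 \<cong> diagonal_centralizer l"
proof (rule is_isoI, rule isoI)
  let ?F = "\<lambda>(P, a). block_sum P (sign_of a)"
  have inv: "block_sum (upper_block Q) (Q $ 3 $ 3) = Q" if "\<And>i j. Q $ i $ j \<noteq> 0 \<Longrightarrow> l i = l j" for Q
    using that[of 1 3] that[of 2 3] that[of 3 1] that[of 3 2] l
    by (auto simp: block_sum_def upper_block_def vec_eq_iff forall_3)
  have inv': "upper_block (block_sum P s) = P" "block_sum P s $ 3 $ 3 = s" for P s
    by (simp_all add: block_sum_def upper_block_def vec_eq_iff forall_2)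
  have sparse: "\<forall>i j. block_sum P s $ i $ j \<noteq> 0 \<longrightarrow> l i = l j" for P s
    using l by (simp add: block_sum_def forall_3)
  show "bij_betw ?F (carrier (O2 \<times>\<times> Z2)) (carrier (diagonal_centralizer l))"
  proof (rule bij_betw_byWitness[where f' = "\<lambda>Q. (upper_block Q, if Q $ 3 $ 3 = 1 then 0 else 1)"])
    show "?F ` carrier (O2 \<times>\<times> Z2) \<subseteq> carrier (diagonal_centralizer l)"
      using sparse
      by (auto simp: orthogonal_group_def diagonal_centralizer_def orthogonal_matrix_block_sum sign_of_def)
    have Q: "orthogonal_matrix (upper_block Q) \<and> (Q $ 3 $ 3 = 1 \<or> Q $ 3 $ 3 = - 1)"
      "block_sum (upper_block Q) (Q $ 3 $ 3) = Q"
      if "Q \<in> carrier (diagonal_centralizer l)" for Q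
    proof -
      show *: "block_sum (upper_block Q) (Q $ 3 $ 3) = Q"
        using that by (intro inv) (auto simp: diagonal_centralizer_def)
      show "orthogonal_matrix (upper_block Q) \<and> (Q $ 3 $ 3 = 1 \<or> Q $ 3 $ 3 = - 1)"
        using that orthogonal_matrix_block_sum[of "upper_block Q" "Q $ 3 $ 3"]
        by (simp add: * diagonal_centralizer_def square_eq_1_iff)
    qed
    show "\<forall>Q\<in>carrier (diagonal_centralizer l). ?F (upper_block Q, if Q $ 3 $ 3 = 1 then 0 else 1) = Q"
      using Q by (auto simp: sign_of_def) metis+
    show "(\<lambda>Q. (upper_block Q, if Q $ 3 $ 3 = 1 then 0 else 1)) ` carrier (diagonal_centralizer l)
        \<subseteq> carrier (O2 \<times>\<times> Z2)"
      using Q by (auto simp: orthogonal_group_def carrier_Z2)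
  qed (auto simp: inv' carrier_Z2 sign_of_def)
  then show "?F \<in> hom (O2 \<times>\<times> Z2) (diagonal_centralizer l)"
    by (intro homI) (auto dest: bij_betwE simp: diagonal_centralizer_def orthogonal_group_def
        block_sum_mult sign_of_mult mult_integer_mod_group)
qed

section \<open>The symmetry group as a centralizer\<close>

text \<open>Indexing the frame by a type makes its coordinates vectors in \<open>real^'n\<close>.
  The assumption \<open>displacement\<close> records what maximality of the frame provides.\<close>

locale complete_eigenframe = higgs_parameters \<Lambda> M K for \<Lambda> M K +
  fixes v :: "'n::finite \<Rightarrow> real^4" and l :: "'n \<Rightarrow> real"
  assumes v_orthonormal: "\<And>i j. mprod (v i) (v j) = (if i = j then - 1 else 0)"
    and A_v: "\<And>i. A (v i) = l i *\<^sub>R v i"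
    and M_v: "\<And>i. M \<bullet> v i = 0"
    and K_v: "\<And>i. K \<bullet> v i = 0"
    and displacement: "\<And>T x. explicit_symmetry \<Lambda> M K T \<Longrightarrow> T x - x \<in> span (range v)"
begin

section \<open>Frame coordinates and the action of matrices\<close>

definition embed :: "real^'n \<Rightarrow> real^4" where
  "embed y = (\<Sum>i\<in>UNIV. y $ i *\<^sub>R v i)"

definition coords :: "real^4 \<Rightarrow> real^'n" where
  "coords x = (\<chi> i. - mprod x (v i))"

definition scale :: "real^'n \<Rightarrow> real^'n" where
  "scale y = (\<chi> i. l i * y $ i)"

text \<open>Applies \<open>Q\<close> to the component in the span of the frame and fixes the
  orthogonal complement.\<close>

definition act :: "real^'n^'n \<Rightarrow> real^4 \<Rightarrow> real^4" where
  "act Q x = x - embed (coords x) + embed (Q *v coords x)"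

lemma linear_embed: "linear embed"
  by (rule linearI) (simp_all add: embed_def scaleR_left_distrib sum.distrib scaleR_sum_right)

lemma linear_coords: "linear coords"
  by (rule linearI) (simp_all add: coords_def vec_eq_iff)

lemma mprod_embed: "mprod x (embed y) = - (coords x \<bullet> y)"
  by (simp add: embed_def coords_def mprod_sum_right inner_vec_def sum_negf mult.commute)

lemma coords_embed [simp]: "coords (embed y) = y"
proof -
  have "mprod (embed y) (v i) = (\<Sum>j\<in>UNIV. if j = i then - y $ i else 0)" for i
    unfolding embed_def mprod_sum_left by (rule sum.cong) (auto simp: v_orthonormal)
  then show ?thesis
    by (simp add: coords_def vec_eq_iff)
qed

lemma A_embed: "A (embed y) = embed (scale y)"
  by (simp add: embed_def scale_def linear_sum[OF linear_A] linear_scale[OF linear_A] A_v mult.commute)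

lemma coords_A: "coords (A x) = scale (coords x)"
  by (simp add: coords_def scale_def vec_eq_iff A_self_adjoint A_v)

lemma M_embed: "M \<bullet> embed y = 0" and K_embed: "K \<bullet> embed y = 0"
  by (simp_all add: embed_def inner_sum_right M_v K_v)

lemma displacement_embed:
  assumes "explicit_symmetry \<Lambda> M K T"
  obtains y where "T x - x = embed y"
proof -
  have "v i = embed (axis i 1)" for i
  proof -
    have "embed (axis i 1) = (\<Sum>j\<in>UNIV. if j = i then v i else 0)"
      unfolding embed_def by (rule sum.cong) (auto simp: axis_def)
    then show ?thesis
      by simp
  qed
  then have "range v \<subseteq> range embed"
    by auto
  then have "span (range v) \<subseteq> range embed"
    by (rule span_minimal) (simp add: linear_subspace_image linear_embed)
  then show thesis
    using displacement[OF assms, of x] that by blast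
qed

lemma coords_act [simp]: "coords (act Q x) = Q *v coords x"
  by (simp add: act_def linear_diff[OF linear_coords] linear_add[OF linear_coords])

lemma act_mult: "act P (act Q x) = act (P ** Q) x"
  by (simp add: act_def[of P] act_def[of "P ** Q"] matrix_vector_mul_assoc) (simp add: act_def)

lemma act_eq_iff: "act P = act Q \<longleftrightarrow> P = Q"
proof
  assume *: "act P = act Q"
  have "P *v y = Q *v y" for y
    using arg_cong[OF fun_cong[OF *, of "embed y"], of coords] by simp
  then show "P = Q"
    by (simp add: matrix_eq)
qed simp

lemma scale_commute_iff:
  "(\<forall>y. scale (Q *v y) = Q *v scale y) \<longleftrightarrow> (\<forall>i j. Q $ i $ j \<noteq> 0 \<longrightarrow> l i = l j)"
proof -
  define D :: "real^'n^'n" where "D = (\<chi> i j. if i = j then l i else 0)"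
  have D: "D *v y = scale y" for y
  proof -
    have "(\<Sum>j\<in>UNIV. (if i = j then l i else 0) * y $ j) = (\<Sum>j\<in>UNIV. if j = i then l i * y $ i else 0)" for i
      by (rule sum.cong) auto
    then show ?thesis
      by (simp add: D_def scale_def matrix_vector_mult_def vec_eq_iff)
  qed
  have DQ: "(D ** Q) $ i $ j = l i * Q $ i $ j" for i j
  proof -
    have "(\<Sum>k\<in>UNIV. (if i = k then l i else 0) * Q $ k $ j) = (\<Sum>k\<in>UNIV. if k = i then l i * Q $ i $ j else 0)"
      by (rule sum.cong) auto
    then show ?thesis
      by (simp add: D_def matrix_matrix_mult_def)
  qed
  have QD: "(Q ** D) $ i $ j = Q $ i $ j * l j" for i j
  proof -
    have "(\<Sum>k\<in>UNIV. Q $ i $ k * (if k = j then l k else 0)) = (\<Sum>k\<in>UNIV. if k = j then Q $ i $ j * l j else 0)"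
      by (rule sum.cong) auto
    then show ?thesis
      by (simp add: D_def matrix_matrix_mult_def)
  qed
  have "D ** Q = Q ** D \<longleftrightarrow> (\<forall>y. scale (Q *v y) = Q *v scale y)"
    by (simp add: matrix_eq D flip: matrix_vector_mul_assoc)
  moreover have "D ** Q = Q ** D \<longleftrightarrow> (\<forall>i j. Q $ i $ j \<noteq> 0 \<longrightarrow> l i = l j)"
    by (auto simp: vec_eq_iff DQ QD mult.commute)
  ultimately show ?thesis
    by simp
qed

text \<open>The frame span and its complement are orthogonal and \<open>A\<close>-invariant. On the
  span \<open>Q\<close> is orthogonal and commutes with the action of \<open>A\<close>, while
  \<open>M\<close> and \<open>K\<close> vanish there.\<close>

lemma act_symmetry:
  assumes "Q \<in> carrier (diagonal_centralizer l)"
  shows "explicit_symmetry \<Lambda> M K (act Q)"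
  unfolding explicit_symmetry_iff
proof (intro conjI allI)
  have orth: "(Q *v x) \<bullet> (Q *v y) = x \<bullet> y" and comm: "scale (Q *v y) = Q *v scale y" for x y
    using assms scale_commute_iff[of Q]
    by (auto simp: diagonal_centralizer_def orthogonal_matrix_inner)
  show "linear (act Q)"
    unfolding act_def
    by (rule linearI)
      (simp_all add: linear_add[OF linear_embed] linear_add[OF linear_coords] linear_scale[OF linear_embed]
        linear_scale[OF linear_coords] matrix_vector_right_distrib matrix_vector_mult_scaleR algebra_simps)
  show "mprod (act Q x) (act Q y) = mprod x y" for x y
    by (simp add: act_def mprod_embed mprod_commute[of "embed _"] linear_diff[OF linear_coords]
        linear_add[OF linear_coords] orth inner_diff_right inner_commute)
  show "A (act Q x) = act Q (A x)" for x
    by (simp add: act_def coords_A A_embed comm linear_add[OF linear_A] linear_diff[OF linear_A])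
  show "M \<bullet> act Q x = M \<bullet> x" "K \<bullet> act Q x = K \<bullet> x" for x
    by (simp_all add: act_def inner_add_right inner_diff_right M_embed K_embed)
qed

text \<open>Displacements lie in the frame span, so \<open>T\<close> maps this span to itself and
  induces a matrix \<open>Q\<close> there. It remains to see that \<open>T\<close> fixes the
  orthogonal complement.\<close>

lemma symmetry_act:
  assumes T: "explicit_symmetry \<Lambda> M K T"
  obtains Q where "Q \<in> carrier (diagonal_centralizer l)" "T = act Q"
proof -
  have lin: "linear T" and iso: "\<And>x y. mprod (T x) (T y) = mprod x y" and comm: "\<And>x. A (T x) = T (A x)"
    using T by (auto simp: explicit_symmetry_iff)
  define Q where "Q = matrix (coords \<circ> T \<circ> embed)"
  have "linear (coords \<circ> T \<circ> embed)"
    by (intro linear_compose linear_embed linear_coords lin)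
  then have Q: "Q *v y = coords (T (embed y))" for y
    by (simp add: Q_def matrix_works)
  have T_embed: "T (embed y) = embed (Q *v y)" for y
  proof -
    obtain z where "T (embed y) - embed y = embed z"
      using displacement_embed[OF T] .
    then have "T (embed y) = embed (y + z)"
      by (simp add: linear_add[OF linear_embed] algebra_simps)
    then show ?thesis
      by (simp add: Q)
  qed
  have embed_inner: "x \<bullet> y = - mprod (embed x) (embed y)" for x y
    by (simp add: mprod_embed)
  have orth: "(Q *v x) \<bullet> (Q *v y) = x \<bullet> y" for x y
    unfolding embed_inner by (simp add: iso flip: T_embed)
  have "embed (scale (Q *v y)) = embed (Q *v scale y)" for y
    using comm[of "embed y"] by (simp add: A_embed T_embed)
  then have "scale (Q *v y) = Q *v scale y" for y
    by (metis coords_embed)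
  then have "Q \<in> carrier (diagonal_centralizer l)"
    using orth scale_commute_iff[of Q] by (simp add: diagonal_centralizer_def orthogonal_matrix_inner)
  moreover have "T x = act Q x" for x
  proof -
    \<comment> \<open>The component of \<open>x\<close> orthogonal to the frame. Its image is
      orthogonal to all \<open>embed (Q *v y)\<close>, hence to the whole span since
      \<open>Q\<close> is onto. The displacement is thus both in the span and orthogonal to it, so
      it is zero.\<close>
    let ?x = "x - embed (coords x)"
    have x0: "coords ?x = 0"
      by (simp add: linear_diff[OF linear_coords])
    have perp: "coords (T ?x) \<bullet> (Q *v y) = 0" for y
      using iso[of ?x "embed y"] x0 by (simp add: T_embed mprod_embed)
    have "orthogonal_matrix Q"
      using orth by (simp add: orthogonal_matrix_inner)
    then have "Q *v (transpose Q *v coords (T ?x)) = coords (T ?x)"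
      by (simp add: matrix_vector_mul_assoc orthogonal_matrix_def del: transpose_matrix_vector)
    then have "coords (T ?x) = 0"
      using perp by (metis inner_eq_zero_iff)
    moreover obtain z where z: "T ?x - ?x = embed z"
      using displacement_embed[OF T] .
    moreover have "z = coords (T ?x) - coords ?x"
      by (simp only: z coords_embed flip: linear_diff[OF linear_coords])
    ultimately have "z = 0"
      using x0 by simp
    then have "T ?x = ?x"
      using z by (simp add: linear_0[OF linear_embed])
    then have "T x - embed (Q *v coords x) = ?x"
      by (simp add: linear_diff[OF lin] T_embed)
    then show ?thesis
      by (simp add: act_def algebra_simps)
  qed
  ultimately show thesis
    using that by blast
qed

lemma act_iso: "act \<in> iso (diagonal_centralizer l) (symmetry_group \<Lambda> M K)"
proof (rule isoI)
  show "act \<in> hom (diagonal_centralizer l) (symmetry_group \<Lambda> M K)"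
  proof (rule homI)
    show "act Q \<in> carrier (symmetry_group \<Lambda> M K)" if "Q \<in> carrier (diagonal_centralizer l)" for Q
      using act_symmetry[OF that] by (simp add: symmetry_group_def)
  qed (simp add: symmetry_group_def diagonal_centralizer_def fun_eq_iff act_mult)
  show "bij_betw act (carrier (diagonal_centralizer l)) (carrier (symmetry_group \<Lambda> M K))"
    unfolding bij_betw_def
  proof
    show "inj_on act (carrier (diagonal_centralizer l))"
      by (simp add: inj_on_def act_eq_iff)
    show "act ` carrier (diagonal_centralizer l) = carrier (symmetry_group \<Lambda> M K)"
    proof
      show "act ` carrier (diagonal_centralizer l) \<subseteq> carrier (symmetry_group \<Lambda> M K)"
        using act_symmetry by (auto simp: symmetry_group_def)
      show "carrier (symmetry_group \<Lambda> M K) \<subseteq> act ` carrier (diagonal_centralizer l)"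
        using symmetry_act by (fastforce simp: symmetry_group_def)
    qed
  qed
qed

text \<open>The matrices \<open>1\<close> and \<open>- 1\<close> act as distinct symmetries, because
  the index type is nonempty.\<close>

lemma not_trivial: "\<not> trivial_group (symmetry_group \<Lambda> M K)"
proof
  assume "trivial_group (symmetry_group \<Lambda> M K)"
  then have "carrier (symmetry_group \<Lambda> M K) = {id}"
    by (simp add: trivial_group_def symmetry_group_def)
  moreover have "act (diag f) \<in> carrier (symmetry_group \<Lambda> M K)" if "\<And>i. f i = 1 \<or> f i = - 1" for f
    using that act_symmetry[of "diag f"]
    by (auto simp: symmetry_group_def diagonal_centralizer_def orthogonal_matrix_diag diag_nth
        split: if_splits)
  ultimately have "act (diag (\<lambda>_. 1)) = act (diag (\<lambda>_. - 1))"
    by auto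
  then have "(\<lambda>_::'n. 1 :: real) = (\<lambda>_. - 1)"
    unfolding act_eq_iff by (rule injD[OF inj_diag])
  then have "(1 :: real) = - 1"
    by (rule fun_cong)
  then show False
    by simp
qed

lemma symmetry_group_iso:
  assumes "group G" "G \<cong> diagonal_centralizer l"
  shows "symmetry_group \<Lambda> M K \<cong> G"
  using assms act_iso by (meson group.iso_sym is_isoI iso_trans)

end

section \<open>From the eigenvalue pattern of a maximal frame to the list of groups\<close>

context higgs_parameters
begin

lemma complete_eigenframeI:
  assumes B: "eigenframe B" and max: "\<And>C. eigenframe C \<Longrightarrow> card C \<le> card B"
    and ev: "\<And>b. b \<in> B \<Longrightarrow> A b = ev b *\<^sub>R b"
    and v: "range v = B" "inj v"
  shows "complete_eigenframe \<Lambda> M K v (\<lambda>i. ev (v i))"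
proof unfold_locales
  have vB: "v i \<in> B" for i
    using v by auto
  show "mprod (v i) (v j) = (if i = j then - 1 else 0)" for i j
    using B vB[of i] vB[of j] v(2) by (auto simp: eigenframe_def inj_eq)
  show "A (v i) = ev (v i) *\<^sub>R v i" for i
    by (rule ev[OF vB])
  show "M \<bullet> v i = 0" "K \<bullet> v i = 0" for i
    using B vB[of i] by (auto simp: eigenframe_def)
  show "T x - x \<in> span (range v)" if "explicit_symmetry \<Lambda> M K T" for T x
    unfolding v(1) using B max that by (rule symmetry_displacement_in_span)
qed

lemma symmetry_group_cases:
  assumes B: "eigenframe B" and max: "\<And>C. eigenframe C \<Longrightarrow> card C \<le> card B"
    and "B \<noteq> {}"
  shows "\<not> trivial_group (symmetry_group \<Lambda> M K) \<and>
    (symmetry_group \<Lambda> M K \<cong> Z2 \<or>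
     symmetry_group \<Lambda> M K \<cong> Z2 \<times>\<times> Z2 \<or>
     symmetry_group \<Lambda> M K \<cong> Z2 \<times>\<times> Z2 \<times>\<times> Z2 \<or>
     symmetry_group \<Lambda> M K \<cong> O2 \<or>
     symmetry_group \<Lambda> M K \<cong> O2 \<times>\<times> Z2 \<or>
     symmetry_group \<Lambda> M K \<cong> O3)"
proof -
  have "\<exists>ev. \<forall>b\<in>B. A b = ev b *\<^sub>R b"
    using B by (intro bchoice) (simp add: eigenframe_def)
  then obtain ev where ev: "\<And>b. b \<in> B \<Longrightarrow> A b = ev b *\<^sub>R b"
    by blast
  note complete = complete_eigenframeI[OF B max ev]
  have Z2: "group Z2" and O2: "group O2" and O3: "group O3"
    by (rule group_integer_mod_group group_orthogonal_group)+
  note groups = Z2 O2 O3 DirProd_group[OF Z2 Z2] DirProd_group[OF Z2 DirProd_group[OF Z2 Z2]]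
    DirProd_group[OF O2 Z2]
  have "card B \<noteq> 0" "card B \<le> 3"
    using B \<open>B \<noteq> {}\<close> eigenframe_card[OF B] by (auto simp: eigenframe_def)
  then consider "card B = 1" | "card B = 2" | "card B = 3"
    by linarith
  then show ?thesis
  proof cases
    case 1
    then obtain b where b: "B = {b}"
      by (auto simp: card_1_singleton_iff)
    interpret complete_eigenframe \<Lambda> M K "\<lambda>_::1. b" "\<lambda>_. ev b"
      by (rule complete) (auto simp: b inj_def)
    show ?thesis
      using not_trivial symmetry_group_iso[OF Z2 Z2_iso] by blast
  next
    case 2
    then obtain b c where bc: "B = {b, c}" "b \<noteq> c"
      by (auto simp: card_2_iff)
    define v :: "2 \<Rightarrow> real^4" where "v i = (if i = 1 then b else c)" for i
    have v: "v 1 = b" "v 2 = c"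
      by (simp_all add: v_def)
    interpret complete_eigenframe \<Lambda> M K v "\<lambda>i. ev (v i)"
    proof (rule complete)
      show "range v = B"
        by (simp add: UNIV_2 v bc(1))
      show "inj v"
        using bc(2) by (simp add: inj_def forall_2 v)
    qed
    show ?thesis
    proof (cases "ev b = ev c")
      case True
      then have "diagonal_centralizer (\<lambda>i. ev (v i)) = O2"
        by (intro diagonal_centralizer_const) (simp add: v_def)
      then show ?thesis
        using not_trivial symmetry_group_iso[OF O2] iso_refl by metis
    next
      case False
      then show ?thesis
        using not_trivial symmetry_group_iso[OF groups(4) Z2_Z2_iso] by (simp add: v)
    qed
  next
    case 3
    then obtain b c d where "B = {b, c, d}" "b \<noteq> c" "b \<noteq> d" "c \<noteq> d"
      by (auto simp: card_3_iff)
    \<comment> \<open>Relabel so that a coincidence of eigenvalues, if there is one, occurs between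
      the first two vectors.\<close>
    then have "\<exists>b c d. B = {b, c, d} \<and> b \<noteq> c \<and> b \<noteq> d \<and> c \<noteq> d \<and>
        (ev b = ev c \<or> ev b \<noteq> ev c \<and> ev b \<noteq> ev d \<and> ev c \<noteq> ev d)"
      by (metis insert_commute)
    then obtain b c d where bcd: "B = {b, c, d}" "b \<noteq> c" "b \<noteq> d" "c \<noteq> d"
      and dist: "ev b = ev c \<or> ev b \<noteq> ev c \<and> ev b \<noteq> ev d \<and> ev c \<noteq> ev d"
      by blast
    define v :: "3 \<Rightarrow> real^4" where "v i = (if i = 1 then b else if i = 2 then c else d)" for i
    have v: "v 1 = b" "v 2 = c" "v 3 = d"
      by (simp_all add: v_def)
    interpret complete_eigenframe \<Lambda> M K v "\<lambda>i. ev (v i)"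
    proof (rule complete)
      show "range v = B"
        by (simp add: UNIV_3 v bcd(1))
      show "inj v"
        using bcd(2-4) by (simp add: inj_def forall_3 v)
    qed
    consider "ev b = ev c" "ev b = ev d" | "ev b = ev c" "ev b \<noteq> ev d"
      | "ev b \<noteq> ev c" "ev b \<noteq> ev d" "ev c \<noteq> ev d"
      using dist by blast
    then show ?thesis
    proof cases
      case 1
      then have "diagonal_centralizer (\<lambda>i. ev (v i)) = O3"
        by (intro diagonal_centralizer_const) (simp add: v_def)
      then show ?thesis
        using not_trivial symmetry_group_iso[OF O3] iso_refl by metis
    next
      case 2
      then show ?thesis
        using not_trivial symmetry_group_iso[OF groups(6) O2_Z2_iso] by (simp add: v)
    next
      case 3
      then show ?thesis
        using not_trivial symmetry_group_iso[OF groups(5) Z2_Z2_Z2_iso] by (simp add: v)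
    qed
  qed
qed

end

theorem proposition2:
  fixes \<Lambda> :: "real^4^4" and M K :: "real^4"
  assumes "transpose \<Lambda> = \<Lambda>"
    and "\<And>r. r \<in> forward_lightcone - {0} \<Longrightarrow> quadratic_form \<Lambda> r > 0"
    and "raise_index K \<in> interior forward_lightcone"
    and "linear_form K (raise_index K) = 1"
  shows "(\<not> trivial_group (symmetry_group \<Lambda> M K) \<longleftrightarrow>
            (\<exists>e. minkowski_eigenvector \<Lambda> e \<and> linear_form M e = 0 \<and> linear_form K e = 0)) \<and>
         (\<not> trivial_group (symmetry_group \<Lambda> M K) \<longrightarrow>
            symmetry_group \<Lambda> M K \<cong> Z2 \<or>
            symmetry_group \<Lambda> M K \<cong> Z2 \<times>\<times> Z2 \<or>
            symmetry_group \<Lambda> M K \<cong> Z2 \<times>\<times> Z2 \<times>\<times> Z2 \<or>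
            symmetry_group \<Lambda> M K \<cong> O2 \<or>
            symmetry_group \<Lambda> M K \<cong> O2 \<times>\<times> Z2 \<or>
            symmetry_group \<Lambda> M K \<cong> O3)"
proof -
  interpret higgs_parameters \<Lambda> M K
    using assms by unfold_locales
  obtain B where B: "eigenframe B" and max: "\<And>C. eigenframe C \<Longrightarrow> card C \<le> card B"
    using maximal_eigenframe by blast
  \<comment> \<open>With an empty maximal frame every displacement lies in the zero space, so each
    symmetry is the identity.\<close>
  have "trivial_group (symmetry_group \<Lambda> M K)" if "B = {}"
  proof -
    have "T = id" if "explicit_symmetry \<Lambda> M K T" for T
      using symmetry_displacement_in_span[OF B max that] \<open>B = {}\<close> by (simp add: fun_eq_iff)
    moreover have "id \<in> carrier (symmetry_group \<Lambda> M K)"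
      using group.is_monoid[OF group_symmetry_group, THEN monoid.one_closed, of \<Lambda> M K]
      by (simp add: symmetry_group_def)
    ultimately show ?thesis
      using group_symmetry_group by (auto simp: trivial_group_def symmetry_group_def)
  qed
  \<comment> \<open>A suitable eigenvector normalises to a one-element frame, so a maximal frame has
    at least one element. Conversely, any frame member is such an eigenvector.\<close>
  moreover have "(\<exists>e. minkowski_eigenvector \<Lambda> e \<and> linear_form M e = 0 \<and> linear_form K e = 0) \<longleftrightarrow> B \<noteq> {}"
  proof
    assume "\<exists>e. minkowski_eigenvector \<Lambda> e \<and> linear_form M e = 0 \<and> linear_form K e = 0"
    then obtain e l where "A e = l *\<^sub>R e" "e \<noteq> 0" "M \<bullet> e = 0" "K \<bullet> e = 0"
      by (auto simp: minkowski_eigenvector_A linear_form_def)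
    then obtain f where "mprod f f = - 1" "A f = l *\<^sub>R f" "M \<bullet> f = 0" "K \<bullet> f = 0"
      using eigenvector_normalise by metis
    then have "eigenframe {f}"
      by (auto simp: eigenframe_def)
    then show "B \<noteq> {}"
      using max by force
  next
    assume "B \<noteq> {}"
    then obtain b where "b \<in> B"
      by blast
    then have "minkowski_eigenvector \<Lambda> b \<and> linear_form M b = 0 \<and> linear_form K b = 0"
      using B by (auto simp: eigenframe_def minkowski_eigenvector_A linear_form_def)
    then show "\<exists>e. minkowski_eigenvector \<Lambda> e \<and> linear_form M e = 0 \<and> linear_form K e = 0"
      by blast
  qed
  ultimately show ?thesis
    using symmetry_group_cases[OF B max] by blast
qed

end
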